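(* Let $f:\mathbb{C}\to\mathbb{R}^3=\operatorname{Im}\mathbb{H}$ be a conformal immersion with mean curvature $H$ such that $H^2 f^*g_{\mathbb{R}^3}$ is a flat metric on $\mathbb{C}$ which is a constant positive multiple of the standard metric, $H^2 f^*g_{\mathbb{R}^3}=c\,|dz|^2$ with $c>0$ constant (i.e. $f$ is a Dirac surface with the plane $\mathbb{C}$ as flat reference surface). Then $f$ is a spin transformation of the plane $f_0=\mathbf{j}z$, that is $$df=\bar\lambda\,\mathbf{j}\,dz\,\lambda ,$$ by a spinor field $\lambda:\mathbb{C}\to\mathbb{H}$ solving the eigenvalue problem $$D\lambda=\mu\lambda\quad\text{for some constant }\mu\in\mathbb{R},$$ where $D$ is the Dirac operator of the plane $f_0=\mathbf{j}z$. More precisely, writing $\lambda=\lambda_1+\mathbf{j}\lambda_2$ with complex valued functions $\lambda_1,\lambda_2$, the following system of equations holds: $$2\mathbf{i}\,\partial\lambda_2=\mu\lambda_1,\qquad 2\mathbf{i}\,\bar\partial\lambda_1=\mu\lambda_2 .$$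
   Context: $\mathbb{H}$ denotes the quaternions with units $\mathbf{i},\mathbf{j},\mathbf{k}$; $\mathbb{R}^3$ is identified with $\operatorname{Im}\mathbb{H}=\{a\in\mathbb{H}: a+\bar a=0\}$, and $\mathbb{C}=\operatorname{span}_{\mathbb{R}}(1,\mathbf{i})\subset\mathbb{H}$. Every $\lambda\in\mathbb{H}$ is written uniquely as $\lambda=\lambda_1+\mathbf{j}\lambda_2$ with $\lambda_1,\lambda_2\in\mathbb{C}$ (complex structure on $\mathbb{H}$: right multiplication by $\mathbf{i}$). Here $z$ is the standard coordinate on $\mathbb{C}$, $\partial=\frac{\partial}{\partial z}$, $\bar\partial=\frac{\partial}{\partial\bar z}$. A conformal immersion $f:M\to\mathbb{R}^3$ of a Riemann surface, with first fundamental form $f^*g_{\mathbb{R}^3}$ and mean curvature $H$, is called a Dirac surface if $H^2f^*g_{\mathbb{R}^3}$ is a (Riemannian) metric of constant Gaussian curvature. A map $\tilde f$ is called a spin transformation of an immersion $f_0$ if $d\tilde f=\bar\lambda\,df_0\,\lambda$ for a quaternion valued function $\lambda$. The Dirac operator of an immersion $f_0$ is $D\lambda=-\dfrac{df_0\wedge d\lambda}{f_0^*\mathrm{vol}}$, where $f_0^*\mathrm{vol}$ is the induced volume form. For the $\{\mathbf{j},\mathbf{k}\}$-plane $f_0=\mathbf{j}z$ it is, with respect to the splitting $\lambda=\lambda_1+\mathbf{j}\lambda_2$, $D=\begin{pmatrix}0&2\mathbf{i}\,\partial\\ 2\mathbf{i}\,\bar\partial&0\end{pmatrix}$. *)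

theory Defs
  imports "HOL-Analysis.Analysis"
begin

codatatype quat = Quat (qre: real) (qim1: real) (qim2: real) (qim3: real)

lemma quat_eqI [intro?]:
  "\<lbrakk>qre x = qre y; qim1 x = qim1 y; qim2 x = qim2 y; qim3 x = qim3 y\<rbrakk> \<Longrightarrow> x = y"
  by (rule quat.expand) simp

lemma quat_eq_iff:
  "x = y \<longleftrightarrow> qre x = qre y \<and> qim1 x = qim1 y \<and> qim2 x = qim2 y \<and> qim3 x = qim3 y"
  by (auto intro: quat.expand)

instantiation quat :: ab_group_add
begin

primcorec zero_quat
  where "qre 0 = 0" | "qim1 0 = 0" | "qim2 0 = 0" | "qim3 0 = 0"

primcorec plus_quat
  where
    "qre (x + y) = qre x + qre y"
  | "qim1 (x + y) = qim1 x + qim1 y"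
  | "qim2 (x + y) = qim2 x + qim2 y"
  | "qim3 (x + y) = qim3 x + qim3 y"

primcorec uminus_quat
  where
    "qre (- x) = - qre x"
  | "qim1 (- x) = - qim1 x"
  | "qim2 (- x) = - qim2 x"
  | "qim3 (- x) = - qim3 x"

primcorec minus_quat
  where
    "qre (x - y) = qre x - qre y"
  | "qim1 (x - y) = qim1 x - qim1 y"
  | "qim2 (x - y) = qim2 x - qim2 y"
  | "qim3 (x - y) = qim3 x - qim3 y"

instance
  by standard (simp_all add: quat_eq_iff)

end

instantiation quat :: ring_1
begin

primcorec one_quat
  where "qre 1 = 1" | "qim1 1 = 0" | "qim2 1 = 0" | "qim3 1 = 0"

primcorec times_quat
  where
    "qre (x * y) = qre x * qre y - qim1 x * qim1 y - qim2 x * qim2 y - qim3 x * qim3 y"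
  | "qim1 (x * y) = qre x * qim1 y + qim1 x * qre y + qim2 x * qim3 y - qim3 x * qim2 y"
  | "qim2 (x * y) = qre x * qim2 y - qim1 x * qim3 y + qim2 x * qre y + qim3 x * qim1 y"
  | "qim3 (x * y) = qre x * qim3 y + qim1 x * qim2 y - qim2 x * qim1 y + qim3 x * qre y"

instance
  by standard (simp_all add: quat_eq_iff algebra_simps)

end

instantiation quat :: real_algebra_1
begin

primcorec scaleR_quat
  where
    "qre (scaleR r x) = r * qre x"
  | "qim1 (scaleR r x) = r * qim1 x"
  | "qim2 (scaleR r x) = r * qim2 x"
  | "qim3 (scaleR r x) = r * qim3 x"

instance
  by standard (simp_all add: quat_eq_iff algebra_simps)

end

instantiation quat :: real_div_algebra
begin

primcorec inverse_quat
  where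
    "qre (inverse x) = qre x / ((qre x)\<^sup>2 + (qim1 x)\<^sup>2 + (qim2 x)\<^sup>2 + (qim3 x)\<^sup>2)"
  | "qim1 (inverse x) = - qim1 x / ((qre x)\<^sup>2 + (qim1 x)\<^sup>2 + (qim2 x)\<^sup>2 + (qim3 x)\<^sup>2)"
  | "qim2 (inverse x) = - qim2 x / ((qre x)\<^sup>2 + (qim1 x)\<^sup>2 + (qim2 x)\<^sup>2 + (qim3 x)\<^sup>2)"
  | "qim3 (inverse x) = - qim3 x / ((qre x)\<^sup>2 + (qim1 x)\<^sup>2 + (qim2 x)\<^sup>2 + (qim3 x)\<^sup>2)"

definition "x div y = x * inverse y" for x y :: quat

instance
proof
  fix x y :: quat
  show "x div y = x * inverse y" by (rule divide_quat_def)
  show "inverse (0::quat) = 0" by (simp add: quat_eq_iff)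
  assume "x \<noteq> 0"
  define n where "n = (qre x)\<^sup>2 + (qim1 x)\<^sup>2 + (qim2 x)\<^sup>2 + (qim3 x)\<^sup>2"
  have "n \<noteq> 0"
    using \<open>x \<noteq> 0\<close> unfolding n_def quat_eq_iff
    by (auto simp: add_nonneg_eq_0_iff)
  have *: "qre (inverse x) = qre x / n" "qim1 (inverse x) = - qim1 x / n"
    "qim2 (inverse x) = - qim2 x / n" "qim3 (inverse x) = - qim3 x / n"
    by (simp_all add: n_def)
  have "qre x * qre x + qim1 x * qim1 x + qim2 x * qim2 x + qim3 x * qim3 x = n"
    by (simp add: n_def power2_eq_square)
  then show "inverse x * x = 1" "x * inverse x = 1"
    using \<open>n \<noteq> 0\<close>
    by (simp_all add: quat_eq_iff * del: inverse_quat.simps) (simp_all add: field_simps)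
qed

end

instantiation quat :: real_inner
begin

definition inner_quat where
  "inner_quat x y = qre x * qre y + qim1 x * qim1 y + qim2 x * qim2 y + qim3 x * qim3 y"
  for x y :: quat

definition norm_quat where "norm_quat x = sqrt (inner x x)" for x :: quat

definition sgn_quat where "sgn_quat x = x /\<^sub>R norm x" for x :: quat

definition dist_quat where "dist_quat x y = norm (x - y)" for x y :: quat

definition uniformity_quat [code del]:
  "(uniformity :: (quat \<times> quat) filter) = (INF e\<in>{0 <..}. principal {(x, y). dist x y < e})"

definition open_quat [code del]:
  "open (U :: quat set) \<longleftrightarrow> (\<forall>x\<in>U. eventually (\<lambda>(x', y). x' = x \<longrightarrow> y \<in> U) uniformity)"

instance
proof
  fix x y z :: quat and r :: real and U :: "quat set"
  show "inner x y = inner y x"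
    by (simp add: inner_quat_def mult.commute)
  show "inner (x + y) z = inner x z + inner y z"
    by (simp add: inner_quat_def algebra_simps)
  show "inner (scaleR r x) y = r * inner x y"
    by (simp add: inner_quat_def algebra_simps)
  show "0 \<le> inner x x"
    by (simp add: inner_quat_def)
  show "inner x x = 0 \<longleftrightarrow> x = 0"
    by (simp add: inner_quat_def quat_eq_iff add_nonneg_eq_0_iff)
  show "norm x = sqrt (inner x x)"
    by (rule norm_quat_def)
qed (rule sgn_quat_def dist_quat_def uniformity_quat open_quat)+

end

instance quat :: real_normed_div_algebra
proof
  fix x y :: quat
  have "inner (x * y) (x * y) = inner x x * inner y y"
    by (simp add: inner_quat_def algebra_simps)
  then show "norm (x * y) = norm x * norm y"
    by (simp add: norm_quat_def real_sqrt_mult)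
qed

definition quat_i :: quat where "quat_i = Quat 0 1 0 0"
definition quat_j :: quat where "quat_j = Quat 0 0 1 0"
definition quat_k :: quat where "quat_k = Quat 0 0 0 1"

lemma quat_unit_sel [simp]:
  "qre quat_i = 0" "qim1 quat_i = 1" "qim2 quat_i = 0" "qim3 quat_i = 0"
  "qre quat_j = 0" "qim1 quat_j = 0" "qim2 quat_j = 1" "qim3 quat_j = 0"
  "qre quat_k = 0" "qim1 quat_k = 0" "qim2 quat_k = 0" "qim3 quat_k = 1"
  by (simp_all add: quat_i_def quat_j_def quat_k_def)

lemma quat_unit_mult:
  "quat_i * quat_i = - 1" "quat_j * quat_j = - 1" "quat_k * quat_k = - 1"
  "quat_i * quat_j = quat_k" "quat_j * quat_k = quat_i" "quat_k * quat_i = quat_j"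
  "quat_j * quat_i = - quat_k" "quat_k * quat_j = - quat_i" "quat_i * quat_k = - quat_j"
  by (simp_all add: quat_eq_iff)

instantiation quat :: euclidean_space
begin

definition Basis_quat where "Basis_quat = {1, quat_i, quat_j, quat_k}"

instance
proof
  show "(Basis :: quat set) \<noteq> {}" "finite (Basis :: quat set)"
    by (simp_all add: Basis_quat_def)
  fix u v :: quat
  show "inner u v = (if u = v then 1 else 0)" if "u \<in> Basis" "v \<in> Basis"
    using that by (auto simp: Basis_quat_def inner_quat_def quat_eq_iff)
  show "(\<forall>w\<in>Basis. inner u w = 0) \<longleftrightarrow> u = 0"
    by (auto simp: Basis_quat_def inner_quat_def intro: quat_eqI)
qed

end

primcorec qcnj :: "quat \<Rightarrow> quat"
  where
    "qre (qcnj x) = qre x"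
  | "qim1 (qcnj x) = - qim1 x"
  | "qim2 (qcnj x) = - qim2 x"
  | "qim3 (qcnj x) = - qim3 x"

definition ImH :: "quat set" where
  "ImH = {a. a + qcnj a = 0}"

text \<open>The inclusion of \<open>\<complex>\<close> into the quaternions as the real span of \<open>1\<close> and \<open>i\<close>.\<close>

definition quat_of_complex :: "complex \<Rightarrow> quat" where
  "quat_of_complex z = Quat (Re z) (Im z) 0 0"

lemma quat_of_complex_sel [simp]:
  "qre (quat_of_complex z) = Re z" "qim1 (quat_of_complex z) = Im z"
  "qim2 (quat_of_complex z) = 0" "qim3 (quat_of_complex z) = 0"
  by (simp_all add: quat_of_complex_def)

lemma quat_splitting:
  "\<exists>!w. q = quat_of_complex (fst w) + quat_j * quat_of_complex (snd w)"
proof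
  let ?w = "(Complex (qre q) (qim1 q), Complex (qim2 q) (- qim3 q))"
  show "q = quat_of_complex (fst ?w) + quat_j * quat_of_complex (snd ?w)"
    by (simp add: quat_eq_iff)
  show "w = ?w" if "q = quat_of_complex (fst w) + quat_j * quat_of_complex (snd w)" for w
    using that by (simp add: quat_eq_iff prod_eq_iff complex_eq_iff)
qed

text \<open>On \<open>ImH\<close>, identified with Euclidean 3-space, this is the vector product.\<close>

definition qcross :: "quat \<Rightarrow> quat \<Rightarrow> quat" where
  "qcross a b = (1/2) *\<^sub>R (a * b - b * a)"

abbreviation differential ::
    "('a::real_normed_vector \<Rightarrow> 'b::real_normed_vector) \<Rightarrow> 'a \<Rightarrow> 'a \<Rightarrow> 'b" where
  "differential f z \<equiv> frechet_derivative f (at z)"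

primrec times_continuously_differentiable ::
    "nat \<Rightarrow> ('a::euclidean_space \<Rightarrow> 'b::real_normed_vector) \<Rightarrow> bool" where
  "times_continuously_differentiable 0 f \<longleftrightarrow> continuous_on UNIV f"
| "times_continuously_differentiable (Suc n) f \<longleftrightarrow>
     (\<forall>z. f differentiable at z) \<and>
     (\<forall>v. times_continuously_differentiable n (\<lambda>z. differential f z v))"

definition smooth :: "('a::euclidean_space \<Rightarrow> 'b::real_normed_vector) \<Rightarrow> bool" where
  "smooth f \<longleftrightarrow> (\<forall>n. times_continuously_differentiable n f)"

text \<open>In the Wirtinger derivatives, the differential applied to \<open>1\<close> and \<open>i\<close> is the partial derivative
  with respect to \<open>x\<close> and \<open>y\<close>, respectively.\<close>

definition partial_z :: "(complex \<Rightarrow> complex) \<Rightarrow> complex \<Rightarrow> complex" where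
  "partial_z g z = (differential g z 1 - \<i> * differential g z \<i>) / 2"

definition partial_zbar :: "(complex \<Rightarrow> complex) \<Rightarrow> complex \<Rightarrow> complex" where
  "partial_zbar g z = (differential g z 1 + \<i> * differential g z \<i>) / 2"

definition first_form :: "(complex \<Rightarrow> quat) \<Rightarrow> complex \<Rightarrow> complex \<Rightarrow> complex \<Rightarrow> real" where
  "first_form f z v w = inner (differential f z v) (differential f z w)"

definition conformal_immersion :: "(complex \<Rightarrow> quat) \<Rightarrow> bool" where
  "conformal_immersion f \<longleftrightarrow>
     range f \<subseteq> ImH \<and> smooth f \<and>
     (\<forall>z. inj (differential f z)) \<and>
     (\<forall>z. \<exists>\<rho>>0. \<forall>v w. first_form f z v w = \<rho> * inner v w)"

text \<open>The sign of the normal is a convention; it determines the sign of the mean curvature.\<close>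

definition unit_normal :: "(complex \<Rightarrow> quat) \<Rightarrow> complex \<Rightarrow> quat" where
  "unit_normal f z = sgn (qcross (differential f z 1) (differential f z \<i>))"

definition second_form :: "(complex \<Rightarrow> quat) \<Rightarrow> complex \<Rightarrow> complex \<Rightarrow> complex \<Rightarrow> real" where
  "second_form f z v w =
     inner (differential (\<lambda>u. differential f u w) z v) (unit_normal f z)"

text \<open>Half the trace of the second with respect to the first fundamental form,
  i.e. \<open>(L G - 2 M F + N E) / (2 (E G - F\<^sup>2))\<close>.\<close>

definition mean_curvature :: "(complex \<Rightarrow> quat) \<Rightarrow> complex \<Rightarrow> real" where
  "mean_curvature f z =
     (let E = first_form f z 1 1; F = first_form f z 1 \<i>; G = first_form f z \<i> \<i>;
          L = second_form f z 1 1; M = second_form f z 1 \<i>; N = second_form f z \<i> \<i>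
      in (L * G - 2 * M * F + N * E) / (2 * (E * G - F\<^sup>2)))"

definition spin_transformation ::
    "(complex \<Rightarrow> quat) \<Rightarrow> (complex \<Rightarrow> quat) \<Rightarrow> (complex \<Rightarrow> quat) \<Rightarrow> bool" where
  "spin_transformation f0 l f \<longleftrightarrow>
     (\<forall>z. (f has_derivative (\<lambda>v. qcnj (l z) * differential f0 z v * l z)) (at z))"

text \<open>The Dirac operator \<open>- (df\<^sub>0 \<and> dl) / f\<^sub>0\<^sup>*vol\<close>: both 2-forms are evaluated on the positively
  oriented frame \<open>(\<partial>\<^sub>x, \<partial>\<^sub>y)\<close>, that is, on \<open>(1, i)\<close>.\<close>

definition area_density :: "(complex \<Rightarrow> quat) \<Rightarrow> complex \<Rightarrow> real" where
  "area_density f z =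
     sqrt (first_form f z 1 1 * first_form f z \<i> \<i> - (first_form f z 1 \<i>)\<^sup>2)"

definition dirac :: "(complex \<Rightarrow> quat) \<Rightarrow> (complex \<Rightarrow> quat) \<Rightarrow> complex \<Rightarrow> quat" where
  "dirac f0 l z =
     - ((differential f0 z 1 * differential l z \<i> - differential f0 z \<i> * differential l z 1)
        /\<^sub>R area_density f0 z)"

definition plane :: "complex \<Rightarrow> quat" where
  "plane z = quat_j * quat_of_complex z"

lemma bounded_linear_quat_of_complex: "bounded_linear quat_of_complex"
  by (rule linear_conv_bounded_linear[THEN iffD1])
     (auto intro!: linearI simp: quat_eq_iff)

lemma differential_plane: "differential plane z v = quat_j * quat_of_complex v"
proof -
  have "bounded_linear (\<lambda>v. quat_j * quat_of_complex v)"
    using bounded_linear_compose[OF bounded_linear_mult_right bounded_linear_quat_of_complex] .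
  then have "(plane has_derivative (\<lambda>v. quat_j * quat_of_complex v)) (at z)"
    unfolding plane_def [abs_def] by (rule bounded_linear_imp_has_derivative)
  from frechet_derivative_at[OF this] show ?thesis by (simp add: fun_eq_iff)
qed

text \<open>In the splitting \<open>\<lambda> = \<lambda>\<^sub>1 + j \<lambda>\<^sub>2\<close>, the Dirac operator of the plane is the matrix with
  rows \<open>(0, 2 i \<partial>)\<close> and \<open>(2 i \<partial>bar, 0)\<close>.\<close>

lemma dirac_plane:
  assumes "l1 differentiable at z" "l2 differentiable at z"
  shows "dirac plane (\<lambda>z. quat_of_complex (l1 z) + quat_j * quat_of_complex (l2 z)) z =
    quat_of_complex (2 * \<i> * partial_z l2 z) + quat_j * quat_of_complex (2 * \<i> * partial_zbar l1 z)"
proof -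
  let ?l = "\<lambda>z. quat_of_complex (l1 z) + quat_j * quat_of_complex (l2 z)"
  let ?d = "\<lambda>v. quat_of_complex (differential l1 z v) + quat_j * quat_of_complex (differential l2 z v)"
  have "(l1 has_derivative differential l1 z) (at z)" "(l2 has_derivative differential l2 z) (at z)"
    using assms by (simp_all add: frechet_derivative_works)
  then have "(?l has_derivative ?d) (at z)"
    by (intro has_derivative_add has_derivative_mult_right
        bounded_linear.has_derivative[OF bounded_linear_quat_of_complex])
  from frechet_derivative_at[OF this] have d: "differential ?l z = ?d" by simp
  have a: "area_density plane z = 1"
    by (simp add: area_density_def first_form_def differential_plane inner_quat_def)
  show ?thesis
    by (simp add: dirac_def a d differential_plane partial_z_def partial_zbar_def quat_eq_iff)
qed

end

theory Submission
  imports Defs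
begin

text \<open>Put \<open>n = |f\<^sub>x|\<close>. Pointwise the conformal frame \<open>(f\<^sub>x, - f\<^sub>y)\<close> is \<open>(qcnj l * j * l, qcnj l * k * l)\<close> with
  \<open>l\<close> unique up to sign, and the operator \<open>m \<mapsto> inner l m *\<^sub>R l\<close> is a linear function of \<open>n\<close>, the
  frame and its normal. As \<open>l \<mapsto> (m \<mapsto> inner l m *\<^sub>R l)\<close> is a two-fold covering onto its image and
  \<open>\<complex>\<close> is simply connected, a continuous \<open>l\<close> exists; it is smooth because \<open>dl\<close> is an algebraic
  expression in \<open>l\<close> and the derivatives of the frame. The integrability condition \<open>f\<^sub>x\<^sub>y = f\<^sub>y\<^sub>x\<close> says that
  \<open>qcnj l * D l\<close> is real, so \<open>D l = \<rho> *\<^sub>R l\<close> for a real function \<open>\<rho>\<close>, and the second fundamental form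
  gives \<open>\<rho> = - H * |l|\<^sup>2\<close>. Hence \<open>\<rho>\<^sup>2 = c\<close>, and \<open>\<rho>\<close> is constant by connectedness.\<close>

section \<open>Smooth functions and the symmetry of second derivatives\<close>

lemma differential_eqI:
  "(f has_derivative f') (at z) \<Longrightarrow> differential f z = f'"
  using frechet_derivative_at by metis

lemma has_differential:
  "f differentiable at z \<Longrightarrow> (f has_derivative differential f z) (at z)"
  using frechet_derivative_works by blast

text \<open>By uniqueness of derivatives, any explicitly computed \<open>f'\<close> may replace
  \<open>differential\<close>, so inductions on the order can use the usual differentiation
  rules.\<close>

lemma times_continuously_differentiable_SucI:
  fixes f :: "'a::euclidean_space \<Rightarrow> 'b::real_normed_vector"
  assumes "\<And>z. (f has_derivative f' z) (at z)"
    and "\<And>v. times_continuously_differentiable n (\<lambda>z. f' z v)"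
  shows "times_continuously_differentiable (Suc n) f"
proof -
  have "differential f = f'"
    using assms(1) by (auto intro!: ext differential_eqI simp: fun_eq_iff[of "differential f"])
  then show ?thesis
    using assms by (auto simp: differentiable_def)
qed

lemma times_continuously_differentiable_SucD:
  assumes "times_continuously_differentiable (Suc n) f"
  shows "(f has_derivative differential f z) (at z)"
    and "times_continuously_differentiable n (\<lambda>z. differential f z v)"
  using assms by (auto intro: has_differential)

lemma times_continuously_differentiable_pred:
  "times_continuously_differentiable (Suc n) f \<Longrightarrow> times_continuously_differentiable n f"
proof (induction n arbitrary: f)
  case 0
  then show ?case
    by (auto intro!: continuous_at_imp_continuous_on differentiable_imp_continuous_within)
next
  case (Suc n)
  then show ?case by (metis times_continuously_differentiable.simps(2))
qed

lemma times_continuously_differentiable_add: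
  assumes "times_continuously_differentiable n f" "times_continuously_differentiable n g"
  shows "times_continuously_differentiable n (\<lambda>z. f z + g z)"
  using assms
proof (induction n arbitrary: f g)
  case 0
  then show ?case by (auto intro: continuous_on_add)
next
  case (Suc n)
  show ?case
    by (rule times_continuously_differentiable_SucI)
      (rule has_derivative_add Suc.IH times_continuously_differentiable_SucD Suc.prems)+
qed

lemma times_continuously_differentiable_bounded_linear:
  assumes "bounded_linear T" "times_continuously_differentiable n f"
  shows "times_continuously_differentiable n (\<lambda>z. T (f z))"
  using assms(2)
proof (induction n arbitrary: f)
  case 0
  then show ?case
    using assms(1) by (auto intro: bounded_linear.continuous_on)
next
  case (Suc n)
  show ?case
    by (rule times_continuously_differentiable_SucI)
      (rule bounded_linear.has_derivative assms(1) Suc.IH times_continuously_differentiable_SucD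
        Suc.prems)+
qed

text \<open>By the product rule each summand pairs a derivative with an undifferentiated factor,
  whose order is lowered to match. One induction serves products, scalar multiples and inner
  products.\<close>

lemma times_continuously_differentiable_bilinear:
  assumes "bounded_bilinear B"
    and "times_continuously_differentiable n f" "times_continuously_differentiable n g"
  shows "times_continuously_differentiable n (\<lambda>z. B (f z) (g z))"
  using assms(2,3)
proof (induction n arbitrary: f g)
  case 0
  then show ?case
    using assms(1) by (auto intro: bounded_bilinear.continuous_on)
next
  case (Suc n)
  show ?case
    by (rule times_continuously_differentiable_SucI)
      (rule Suc.prems bounded_bilinear.FDERIV assms(1) Suc.IH times_continuously_differentiable_SucD
        times_continuously_differentiable_add times_continuously_differentiable_pred)+
qed

text \<open>The derivative involves only \<open>inverse g\<close> and the derivative of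
  \<open>g\<close>, so the induction closes.\<close>

lemma times_continuously_differentiable_inverse:
  fixes g :: "'a::euclidean_space \<Rightarrow> real"
  assumes "times_continuously_differentiable n g" "\<And>z. g z \<noteq> 0"
  shows "times_continuously_differentiable n (\<lambda>z. inverse (g z))"
  using assms(1)
proof (induction n)
  case 0
  then show ?case by (auto intro: continuous_on_inverse simp: assms(2))
next
  case (Suc n)
  note mult = times_continuously_differentiable_bilinear[OF bounded_bilinear_mult]
  show ?case
  proof (rule times_continuously_differentiable_SucI)
    show "((\<lambda>z. inverse (g z)) has_derivative
        (\<lambda>v. - (inverse (g z) * differential g z v * inverse (g z)))) (at z)" for z
      by (intro Deriv.has_derivative_inverse assms(2)
          times_continuously_differentiable_SucD(1)[OF Suc.prems])
    show "times_continuously_differentiable n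
        (\<lambda>z. - (inverse (g z) * differential g z v * inverse (g z)))" for v
      by (intro times_continuously_differentiable_bounded_linear[OF bounded_linear_minus]
          bounded_linear_ident mult Suc.IH times_continuously_differentiable_pred[OF Suc.prems]
          times_continuously_differentiable_SucD(2)[OF Suc.prems])
  qed
qed

lemma smooth_imp_has_derivative:
  "smooth f \<Longrightarrow> (f has_derivative differential f z) (at z)"
  unfolding smooth_def using times_continuously_differentiable_SucD(1) by blast

lemma smooth_differential: "smooth f \<Longrightarrow> smooth (\<lambda>z. differential f z v)"
  unfolding smooth_def using times_continuously_differentiable_SucD(2) by blast

lemma smooth_imp_continuous: "smooth f \<Longrightarrow> continuous_on UNIV f"
  unfolding smooth_def by (metis times_continuously_differentiable.simps(1))

section \<open>Symmetry of second derivatives\<close>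

text \<open>The mean value theorem is applied twice: along \<open>u\<close> to the difference of
  \<open>g\<close> on two parallel segments, then along \<open>v\<close> to \<open>g' z u\<close> as
  a function of the base point.\<close>

lemma second_difference_mvt:
  fixes g :: "'a::real_normed_vector \<Rightarrow> real"
  assumes g: "\<And>z. (g has_derivative g' z) (at z)"
    and gu: "\<And>z. ((\<lambda>z. g' z u) has_derivative g'' z) (at z)"
    and "h > 0"
  obtains s t where "0 \<le> s" "s \<le> h" "0 \<le> t" "t \<le> h"
    "g (z + h *\<^sub>R u + h *\<^sub>R v) - g (z + h *\<^sub>R u) - g (z + h *\<^sub>R v) + g z
      = h * h * g'' (z + s *\<^sub>R u + t *\<^sub>R v) v"
proof -
  let ?p = "\<lambda>s. g (z + s *\<^sub>R u + h *\<^sub>R v) - g (z + s *\<^sub>R u)"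
  have lin: "linear (g' z)" "linear (g'' z)" for z
    using g gu has_derivative_linear by blast+
  have "(?p has_derivative
      (\<lambda>d. g' (z + s *\<^sub>R u + h *\<^sub>R v) (d *\<^sub>R u) - g' (z + s *\<^sub>R u) (d *\<^sub>R u))) (at s within {0..h})" for s
    by (intro has_derivative_diff has_derivative_compose[OF _ g])
      (auto intro!: derivative_eq_intros)
  from mvt_very_simple[OF less_imp_le[OF \<open>h > 0\<close>] this] obtain s where s: "0 \<le> s" "s \<le> h"
    "?p h - ?p 0 = g' (z + s *\<^sub>R u + h *\<^sub>R v) (h *\<^sub>R u) - g' (z + s *\<^sub>R u) (h *\<^sub>R u)"
    by auto
  have "((\<lambda>t. g' (z + s *\<^sub>R u + t *\<^sub>R v) u) has_derivative
      (\<lambda>d. g'' (z + s *\<^sub>R u + t *\<^sub>R v) (d *\<^sub>R v))) (at t within {0..h})" for t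
    by (intro has_derivative_compose[OF _ gu]) (auto intro!: derivative_eq_intros)
  from mvt_very_simple[OF less_imp_le[OF \<open>h > 0\<close>] this] obtain t where t: "0 \<le> t" "t \<le> h"
    "g' (z + s *\<^sub>R u + h *\<^sub>R v) u - g' (z + s *\<^sub>R u + 0 *\<^sub>R v) u = g'' (z + s *\<^sub>R u + t *\<^sub>R v) (h *\<^sub>R v)"
    by auto
  show ?thesis
  proof (rule that[OF s(1,2) t(1,2)])
    show "g (z + h *\<^sub>R u + h *\<^sub>R v) - g (z + h *\<^sub>R u) - g (z + h *\<^sub>R v) + g z
      = h * h * g'' (z + s *\<^sub>R u + t *\<^sub>R v) v"
      using s(3) t(3) unfolding lin(1)[THEN linear_scale] lin(2)[THEN linear_scale] real_scaleR_def
      by (simp flip: right_diff_distrib)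
  qed
qed

text \<open>The second difference over a parallelogram is symmetric in \<open>u\<close> and
  \<open>v\<close>, so its two mean value expressions agree. Shrinking the parallelogram, continuity
  brings both within \<open>e/2\<close> of their values at \<open>z\<close>.\<close>

lemma symmetric_second_derivative_real:
  fixes g :: "'a::real_normed_vector \<Rightarrow> real"
  assumes g: "\<And>z. (g has_derivative g' z) (at z)"
    and gu: "\<And>z. ((\<lambda>z. g' z u) has_derivative gu z) (at z)"
    and gv: "\<And>z. ((\<lambda>z. g' z v) has_derivative gv z) (at z)"
    and cu: "isCont (\<lambda>z. gu z v) z" and cv: "isCont (\<lambda>z. gv z u) z"
  shows "gu z v = gv z u"
proof -
  have "dist (gu z v) (gv z u) \<le> e" if "e > 0" for e
  proof -
    obtain d1 where d1: "d1 > 0" "\<And>y. dist y z < d1 \<Longrightarrow> dist (gu y v) (gu z v) < e/2"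
      using cu \<open>e > 0\<close> unfolding continuous_at_eps_delta by (metis half_gt_zero)
    obtain d2 where d2: "d2 > 0" "\<And>y. dist y z < d2 \<Longrightarrow> dist (gv y u) (gv z u) < e/2"
      using cv \<open>e > 0\<close> unfolding continuous_at_eps_delta by (metis half_gt_zero)
    \<comment> \<open>Points of the parallelogram have distance at most \<open>h * K\<close> from
      \<open>z\<close>. The summand 1 keeps \<open>K\<close> positive when \<open>u\<close> and
      \<open>v\<close> vanish, and \<open>h\<close> makes \<open>h * K\<close> half the smaller
      radius.\<close>
    define K where "K = norm u + norm v + 1"
    have "K > 0"
      unfolding K_def by (smt (verit) norm_ge_zero)
    define h where "h = min d1 d2 / 2 / K"
    have "h * K = min d1 d2 / 2"
      using \<open>K > 0\<close> unfolding h_def by simp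
    then have h: "h > 0" "h * K < min d1 d2"
      using d1(1) d2(1) \<open>K > 0\<close> unfolding h_def by auto
    have near: "dist (z + s *\<^sub>R a + t *\<^sub>R b) z < min d1 d2"
      if "0 \<le> s" "s \<le> h" "0 \<le> t" "t \<le> h" "norm a + norm b = norm u + norm v" for s t a b
    proof -
      have "dist (z + s *\<^sub>R a + t *\<^sub>R b) z \<le> norm (s *\<^sub>R a) + norm (t *\<^sub>R b)"
        by (simp add: dist_norm add.assoc norm_triangle_ineq del: norm_scaleR)
      also have "\<dots> \<le> h * norm a + h * norm b"
        using that by (intro add_mono) (auto intro: mult_right_mono)
      also have "\<dots> \<le> h * K"
        using that h(1) unfolding K_def by (simp flip: distrib_left)
      finally show ?thesis using h(2) by linarith
    qed
    obtain s t where st: "0 \<le> s" "s \<le> h" "0 \<le> t" "t \<le> h"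
      "g (z + h *\<^sub>R u + h *\<^sub>R v) - g (z + h *\<^sub>R u) - g (z + h *\<^sub>R v) + g z
        = h * h * gu (z + s *\<^sub>R u + t *\<^sub>R v) v"
      using second_difference_mvt[OF g gu \<open>h > 0\<close>] by blast
    obtain s' t' where st': "0 \<le> s'" "s' \<le> h" "0 \<le> t'" "t' \<le> h"
      "g (z + h *\<^sub>R v + h *\<^sub>R u) - g (z + h *\<^sub>R v) - g (z + h *\<^sub>R u) + g z
        = h * h * gv (z + s' *\<^sub>R v + t' *\<^sub>R u) u"
      using second_difference_mvt[OF g gv \<open>h > 0\<close>] by blast
    have comm: "z + h *\<^sub>R v + h *\<^sub>R u = z + h *\<^sub>R u + h *\<^sub>R v"
      by (simp add: algebra_simps)
    have "h * h * gu (z + s *\<^sub>R u + t *\<^sub>R v) v = h * h * gv (z + s' *\<^sub>R v + t' *\<^sub>R u) u"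
      by (simp only: st(5)[symmetric] st'(5)[symmetric] comm)
    then have "gu (z + s *\<^sub>R u + t *\<^sub>R v) v = gv (z + s' *\<^sub>R v + t' *\<^sub>R u) u"
      using h(1) by simp
    moreover have "dist (gu (z + s *\<^sub>R u + t *\<^sub>R v) v) (gu z v) < e/2"
      using near[OF st(1-4)] by (intro d1(2)) simp
    moreover have "dist (gv (z + s' *\<^sub>R v + t' *\<^sub>R u) u) (gv z u) < e/2"
      using near[OF st'(1-4)] by (intro d2(2)) (simp add: add.commute)
    ultimately show ?thesis
      unfolding dist_real_def by linarith
  qed
  then show ?thesis
    using field_le_epsilon[of "dist (gu z v) (gv z u)" 0] by simp
qed

lemma symmetric_second_differential:
  fixes f :: "'a::euclidean_space \<Rightarrow> 'b::euclidean_space"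
  assumes "smooth f"
  shows "differential (\<lambda>z. differential f z u) z v = differential (\<lambda>z. differential f z v) z u"
proof (rule euclidean_eqI)
  fix e :: 'b
  note d = smooth_imp_has_derivative and s = smooth_differential
  have "isCont (\<lambda>z. differential (\<lambda>z. differential f z u) z v) z" for u v
    using smooth_imp_continuous[OF s[OF s[OF assms]]] by (simp add: continuous_on_eq_continuous_at)
  then have c: "isCont (\<lambda>z. inner (differential (\<lambda>z. differential f z u) z v) e) z" for u v
    by (intro continuous_intros)
  show "inner (differential (\<lambda>z. differential f z u) z v) e
    = inner (differential (\<lambda>z. differential f z v) z u) e"
    by (rule symmetric_second_derivative_real[where g="\<lambda>z. inner (f z) e"
          and g'="\<lambda>z v. inner (differential f z v) e"
          and gu="\<lambda>z v. inner (differential (\<lambda>z. differential f z u) z v) e"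
          and gv="\<lambda>z w. inner (differential (\<lambda>z. differential f z v) z w) e"])
      (rule has_derivative_inner_left d s assms c)+
qed

section \<open>The covering of rank-one operators\<close>

text \<open>This is \<open>inner l l\<close> times the orthogonal projection onto the line of
  \<open>l\<close>. Bounded operators form a normed space, which gives the image the topology needed
  for a covering map.\<close>

definition rank_one :: "'a::euclidean_space \<Rightarrow> 'a \<Rightarrow>\<^sub>L 'a" where
  "rank_one l = Blinfun (\<lambda>m. inner l m *\<^sub>R l)"

lemma rank_one_apply: "rank_one l m = inner l m *\<^sub>R l"
  unfolding rank_one_def
  by (subst bounded_linear_Blinfun_apply) (auto intro!: bounded_linear_intros)

lemma continuous_on_rank_one: "continuous_on S rank_one"
  by (intro continuous_on_blinfun_componentwise) (simp add: rank_one_apply, intro continuous_intros)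

lemma rank_one_uminus: "rank_one (- l) = rank_one l"
  by (intro blinfun_eqI) (simp add: rank_one_apply)

text \<open>Comparing the quadratic forms at \<open>l\<close> and at \<open>l'\<close> gives equal
  norms and equality in the Cauchy-Schwarz inequality.\<close>

lemma rank_one_eqD:
  assumes "rank_one l = rank_one l'"
  shows "l' = l \<or> l' = - l"
proof -
  have "(inner l m)\<^sup>2 = (inner l' m)\<^sup>2" for m
    using arg_cong[OF assms, of "\<lambda>A. inner (blinfun_apply A m) m"]
    by (simp add: rank_one_apply power2_eq_square)
  from this[of l] this[of l'] have "(inner l l)\<^sup>2 = (inner l' l')\<^sup>2" "(inner l l')\<^sup>2 = (inner l l)\<^sup>2"
    by (simp_all add: inner_commute)
  then have "inner l' l' = inner l l" "inner l l' = inner l l \<or> inner l l' = - inner l l"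
    by (metis inner_ge_zero power2_eq_iff_nonneg, simp add: power2_eq_iff)
  then have "inner (l' - l) (l' - l) = 0 \<or> inner (l' + l) (l' + l) = 0"
    by (auto simp: algebra_simps inner_diff inner_add inner_commute)
  then show ?thesis
    by (auto simp: eq_neg_iff_add_eq_0)
qed

text \<open>On the half space where \<open>inner l l0\<close> has the sign \<open>s\<close>, the vector \<open>l\<close> is recovered from
  \<open>A = rank_one l\<close> as \<open>A l0 = inner l l0 *\<^sub>R l\<close>, up to a positive factor.\<close>

lemma homeomorphism_rank_one_half_space:
  fixes l0 :: "'a::euclidean_space"
  assumes s: "s\<^sup>2 = 1"
  shows "homeomorphism {l. 0 < s * inner l l0} (rank_one ` UNIV \<inter> {A. 0 < inner (blinfun_apply A l0) l0})
    rank_one (\<lambda>A. (s / sqrt (inner (blinfun_apply A l0) l0)) *\<^sub>R blinfun_apply A l0)"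
    (is "homeomorphism ?U ?T _ ?q")
proof -
  have s': "s = 1 \<or> s = -1"
    using s by (simp add: power2_eq_1_iff)
  \<comment> \<open>The root of \<open>(inner l l0)\<^sup>2\<close> is an absolute value, so only
    the sign of \<open>inner l l0\<close> survives.\<close>
  have q: "?q (rank_one l) = (s * sgn (inner l l0)) *\<^sub>R l" for l
    by (simp add: rank_one_apply sgn_if divide_inverse)
  have U: "?q (rank_one l) = l" if "l \<in> ?U" for l
    unfolding q using that s' by (auto simp: sgn_if zero_less_mult_iff)
  show ?thesis
  proof (rule homeomorphismI)
    show "continuous_on ?T ?q"
      by (intro continuous_intros) auto
    show "?q ` ?T \<subseteq> ?U"
    proof (rule image_subsetI)
      fix A
      assume "A \<in> ?T"
      then obtain l where l: "A = rank_one l" "inner l l0 \<noteq> 0"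
        by (fastforce simp: rank_one_apply)
      have "s * inner (?q A) l0 = s\<^sup>2 * (sgn (inner l l0) * inner l l0)"
        unfolding l q by (simp add: power2_eq_square)
      then show "?q A \<in> ?U"
        using s l(2) by (simp add: sgn_if)
    qed
    show "rank_one (?q A) = A" if A: "A \<in> ?T" for A
    proof -
      obtain l where l: "A = rank_one l" and "inner l l0 \<noteq> 0"
        using A by (fastforce simp: rank_one_apply)
      from this(2) have "?q A = l \<or> ?q A = - l"
        using s' unfolding l q by (auto simp: sgn_if)
      then show ?thesis by (metis l rank_one_uminus)
    qed
    show "rank_one ` ?U \<subseteq> ?T"
      by (auto simp: rank_one_apply zero_less_mult_iff)
  qed (fact continuous_on_rank_one U)+
qed

text \<open>Around \<open>rank_one l0\<close> the evenly covered neighbourhood consists of the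
  operators of vectors not orthogonal to \<open>l0\<close>; its two sheets are the open half spaces
  \<open>U 1\<close> and \<open>U (-1)\<close>.\<close>

lemma covering_space_rank_one:
  "covering_space (- {0::'a::euclidean_space}) rank_one (rank_one ` (- {0}))"
  unfolding covering_space_def
proof (intro conjI ballI)
  fix x :: "'a \<Rightarrow>\<^sub>L 'a"
  assume "x \<in> rank_one ` (- {0})"
  then obtain l0 where l0: "x = rank_one l0" "l0 \<noteq> 0" by auto
  define U where "U s = {l. 0 < s * inner l l0}" for s :: real
  define O' where "O' = {A :: 'a \<Rightarrow>\<^sub>L 'a. 0 < inner (blinfun_apply A l0) l0}"
  have O': "open O'"
    unfolding O'_def by (intro open_Collect_less continuous_intros)
  have U: "open (U s)" for s
    unfolding U_def by (intro open_Collect_less continuous_intros)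
  \<comment> \<open>The zero vector gives the zero operator, which is outside
    \<open>O'\<close>.\<close>
  have T: "range rank_one \<inter> O' = rank_one ` (- {0}) \<inter> O'"
    unfolding O'_def by (auto simp: rank_one_apply)
  have "homeomorphism (U s) (range rank_one \<inter> O') rank_one
      (\<lambda>A. (s / sqrt (inner (blinfun_apply A l0) l0)) *\<^sub>R blinfun_apply A l0)" if "s\<^sup>2 = 1" for s
    unfolding U_def O'_def by (rule homeomorphism_rank_one_half_space[OF that])
  then have "\<exists>q. homeomorphism (U s) (range rank_one \<inter> O') rank_one q" if "s\<^sup>2 = 1" for s
    using that by blast
  then have hom: "\<forall>u\<in>{U 1, U (-1)}. \<exists>q. homeomorphism u (rank_one ` (- {0}) \<inter> O') rank_one q"
    unfolding T by simp
  have R1: "rank_one l \<in> O' \<longleftrightarrow> inner l l0 \<noteq> 0" for l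
    by (auto simp: O'_def rank_one_apply zero_less_mult_iff)
  have R2: "rank_one l \<in> rank_one ` (- {0})" "l \<noteq> 0" if "inner l l0 \<noteq> 0" for l
    using that by (auto intro!: imageI)
  show "\<exists>T. x \<in> T \<and> openin (top_of_set (rank_one ` (- {0}))) T \<and>
     (\<exists>v. \<Union> v = - {0} \<inter> rank_one -` T \<and> (\<forall>u\<in>v. openin (top_of_set (- {0})) u) \<and>
        pairwise disjnt v \<and> (\<forall>u\<in>v. \<exists>q. homeomorphism u T rank_one q))"
  proof (intro exI[of _ "rank_one ` (- {0}) \<inter> O'"] exI[of _ "{U 1, U (-1)}"] conjI hom)
    show "x \<in> rank_one ` (- {0}) \<inter> O'"
      using l0 by (auto simp: O'_def rank_one_apply)
    show "openin (top_of_set (rank_one ` (- {0}))) (rank_one ` (- {0}) \<inter> O')"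
      using O' by (simp add: openin_open_Int)
    show "\<Union> {U 1, U (- 1)} = - {0} \<inter> rank_one -` (rank_one ` (- {0}) \<inter> O')"
    proof (rule set_eqI)
      fix l
      have "l \<in> \<Union> {U 1, U (- 1)} \<longleftrightarrow> inner l l0 \<noteq> 0"
        by (auto simp: U_def)
      then show "l \<in> \<Union> {U 1, U (- 1)} \<longleftrightarrow> l \<in> - {0} \<inter> rank_one -` (rank_one ` (- {0}) \<inter> O')"
        using R1[of l] R2[of l] by blast
    qed
    show "\<forall>u\<in>{U 1, U (- 1)}. openin (top_of_set (- {0})) u"
    proof
      fix u
      assume "u \<in> {U 1, U (-1)}"
      moreover have "U s \<subseteq> - {0}" for s
        by (auto simp: U_def)
      ultimately show "openin (top_of_set (- {0})) u"
        using U by (auto intro: open_subset)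
    qed
    show "pairwise disjnt {U 1, U (-1)}"
      by (auto simp: pairwise_def disjnt_def U_def)
  qed
qed (auto intro: continuous_on_rank_one)

section \<open>Spin lifts of conformal frames\<close>

text \<open>The multiplication table for products bracketed to the right, the normal form produced
  by \<open>mult.assoc\<close>.\<close>

lemma quat_unit_mult_left:
  "quat_i * (quat_i * x) = - x" "quat_j * (quat_j * x) = - x" "quat_k * (quat_k * x) = - x"
  "quat_i * (quat_j * x) = quat_k * x" "quat_j * (quat_k * x) = quat_i * x"
  "quat_k * (quat_i * x) = quat_j * x" "quat_j * (quat_i * x) = - (quat_k * x)"
  "quat_k * (quat_j * x) = - (quat_i * x)" "quat_i * (quat_k * x) = - (quat_j * x)"
  by (simp_all add: quat_unit_mult flip: mult.assoc)

lemma qcnj_mult: "qcnj (x * y) = qcnj y * qcnj x"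
  by (simp add: quat_eq_iff algebra_simps)

lemma qcnj_qcnj: "qcnj (qcnj x) = x"
  by (simp add: quat_eq_iff)

lemma qcnj_mult_self: "qcnj x * x = of_real (inner x x)"
  by (simp add: of_real_def quat_eq_iff inner_quat_def algebra_simps)

lemma mult_qcnj_self: "x * qcnj x = of_real (inner x x)"
  by (simp add: of_real_def quat_eq_iff inner_quat_def algebra_simps)

lemma of_real_mult_quat: "of_real r * x = r *\<^sub>R x" "x * of_real r = r *\<^sub>R x" for x :: quat
  by (simp_all add: of_real_def)

lemma ImH_iff: "a \<in> ImH \<longleftrightarrow> qre a = 0"
  by (simp add: ImH_def quat_eq_iff)

lemma ImH_mult_self: "a \<in> ImH \<Longrightarrow> a * a = - of_real (inner a a)"
  by (simp add: ImH_iff of_real_def quat_eq_iff inner_quat_def)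

lemma ImH_mult_commute_orthogonal:
  "a \<in> ImH \<Longrightarrow> b \<in> ImH \<Longrightarrow> inner a b = 0 \<Longrightarrow> b * a = - (a * b)"
  by (simp add: ImH_iff quat_eq_iff inner_quat_def algebra_simps)

text \<open>The averaging identity \<open>q - i q i - j q j - k q k = 4 Re q\<close> for \<open>q = m * qcnj l\<close>, multiplied by \<open>l\<close>
  on the right, expresses \<open>4 * inner l m *\<^sub>R l\<close> by \<open>n = |l|\<^sup>2\<close>, \<open>a = qcnj l * j * l\<close>, \<open>b = qcnj l * k * l\<close>
  and \<open>qcnj l * i * l = a * b / n\<close>.\<close>

definition spin_matrix :: "real \<Rightarrow> quat \<Rightarrow> quat \<Rightarrow> quat \<Rightarrow> quat" where
  "spin_matrix n a b m = (1/4) *\<^sub>R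
     (n *\<^sub>R m - (1/n) *\<^sub>R (quat_i * m * (a * b)) - quat_j * m * a - quat_k * m * b)"

lemma spin_matrix_eq_rank_one:
  assumes "l \<noteq> 0"
  shows "spin_matrix (inner l l) (qcnj l * quat_j * l) (qcnj l * quat_k * l) m = inner l m *\<^sub>R l"
proof -
  have "(qcnj l * quat_j * l) * (qcnj l * quat_k * l) = qcnj l * quat_j * (l * qcnj l) * quat_k * l"
    by (simp add: mult.assoc)
  also have "\<dots> = inner l l *\<^sub>R (qcnj l * quat_i * l)"
    unfolding mult_qcnj_self of_real_mult_quat by (simp add: mult.assoc quat_unit_mult_left)
  finally have ab: "(qcnj l * quat_j * l) * (qcnj l * quat_k * l) = \<dots>" .
  have "inner l l *\<^sub>R m - quat_i * m * (qcnj l * quat_i * l) - quat_j * m * (qcnj l * quat_j * l)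
      - quat_k * m * (qcnj l * quat_k * l) = 4 *\<^sub>R inner l m *\<^sub>R l"
    by (simp add: quat_eq_iff inner_quat_def algebra_simps)
  then show ?thesis
    using assms unfolding spin_matrix_def ab by simp
qed

text \<open>The operator \<open>w\<close>, four times \<open>spin_matrix n a b\<close>, turns right
  multiplication by \<open>a\<close> and \<open>b\<close> into \<open>n\<close> times left
  multiplication by \<open>quat_j\<close> and \<open>quat_k\<close>. Hence any nonzero value of
  \<open>w\<close>, suitably scaled, conjugates \<open>quat_j\<close> to \<open>a\<close> and
  \<open>quat_k\<close> to \<open>b\<close>.\<close>

lemma conformal_frame_eq_spin:
  assumes ab: "a \<in> ImH" "b \<in> ImH" "inner a b = 0" "inner a a = n\<^sup>2" "inner b b = n\<^sup>2" and n: "n > 0"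
  obtains l where "qcnj l * quat_j * l = a" "qcnj l * quat_k * l = b" "inner l l = n"
proof -
  define c where "c = (1/n) *\<^sub>R (a * b)"
  define w where "w m = n *\<^sub>R m - quat_i * m * c - quat_j * m * a - quat_k * m * b" for m
  have aa: "a * a = - (n *\<^sub>R n *\<^sub>R 1)" "b * b = - (n *\<^sub>R n *\<^sub>R 1)"
    using ab by (simp_all add: ImH_mult_self of_real_def power2_eq_square)
  have abc: "a * b = n *\<^sub>R c"
    using n by (simp add: c_def)
  have bac: "b * a = - (n *\<^sub>R c)"
    using ImH_mult_commute_orthogonal[OF ab(1-3)] abc by simp
  have "n *\<^sub>R (c * a) = - (a * (a * b))"
    using abc bac by (metis mult.assoc mult_minus_left mult_minus_right mult_scaleR_left minus_minus)
  also have "\<dots> = n *\<^sub>R n *\<^sub>R b"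
    by (simp add: aa flip: mult.assoc)
  finally have ca: "c * a = n *\<^sub>R b"
    using n by (metis scaleR_cancel_left less_irrefl)
  have "n *\<^sub>R (c * b) = a * b * b"
    using abc by simp
  also have "\<dots> = - (n *\<^sub>R n *\<^sub>R a)"
    by (simp add: aa mult.assoc)
  finally have cb: "c * b = - (n *\<^sub>R a)"
    using n by (metis scaleR_minus_right scaleR_cancel_left less_irrefl)
  have wa: "w m * a = n *\<^sub>R (quat_j * w m)" and wb: "w m * b = n *\<^sub>R (quat_k * w m)" for m
    by (simp_all add: w_def algebra_simps aa abc bac ca cb quat_unit_mult_left)
  \<comment> \<open>A second averaging shows that \<open>w\<close> is nonzero at one of the four
    units: all terms in \<open>a\<close>, \<open>b\<close>, \<open>c\<close> cancel.\<close>
  have "w 1 - quat_i * w quat_i - quat_j * w quat_j - quat_k * w quat_k = (4 * n) *\<^sub>R 1"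
    by (simp add: w_def algebra_simps quat_unit_mult_left quat_unit_mult)
       (simp add: quat_eq_iff)
  moreover have "(4 * n) *\<^sub>R (1::quat) \<noteq> 0"
    using n by simp
  ultimately obtain m where m: "w m \<noteq> 0"
    by (metis diff_zero mult_zero_right)
  \<comment> \<open>This scaling gives squared norm \<open>n\<close>, and \<open>r * r\<close>
    cancels the factor \<open>inner (w m) (w m) / n\<close> left by conjugation.\<close>
  define r where "r = sqrt (n / inner (w m) (w m))"
  have r: "r * r = n / inner (w m) (w m)"
    using n unfolding r_def by simp
  have conj: "qcnj (r *\<^sub>R w m) * u * (r *\<^sub>R w m) = d" if "w m * d = n *\<^sub>R (u * w m)" for u d
  proof -
    have "n *\<^sub>R (qcnj (w m) * u * w m) = qcnj (w m) * (w m * d)"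
      unfolding that by (simp add: mult.assoc)
    also have "\<dots> = inner (w m) (w m) *\<^sub>R d"
      by (simp add: qcnj_mult_self of_real_mult_quat flip: mult.assoc)
    finally have "qcnj (w m) * u * w m = (inner (w m) (w m) / n) *\<^sub>R d"
      using n by (metis divide_inverse_commute less_irrefl real_vector_affinity_eq scaleR_scaleR
          scaleR_left_imp_eq right_inverse scaleR_one)
    moreover have "qcnj (r *\<^sub>R w m) * u * (r *\<^sub>R w m) = (r * r) *\<^sub>R (qcnj (w m) * u * w m)"
      by (simp add: quat_eq_iff algebra_simps)
    ultimately show ?thesis
      using n m by (simp add: r)
  qed
  show ?thesis
  proof (rule that)
    show "qcnj (r *\<^sub>R w m) * quat_j * (r *\<^sub>R w m) = a" "qcnj (r *\<^sub>R w m) * quat_k * (r *\<^sub>R w m) = b"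
      using conj wa wb by blast+
    show "inner (r *\<^sub>R w m) (r *\<^sub>R w m) = n"
      using m by (simp add: r flip: mult.assoc)
  qed
qed

section \<open>Continuous and differentiable lifts over the plane\<close>

text \<open>A pointwise choice \<open>p\<close> need not be continuous, but
  \<open>rank_one (p z)\<close> is, since \<open>spin_matrix\<close> expresses it by the continuous
  frame data. It therefore lifts through the covering.\<close>

lemma continuous_spin_lift:
  fixes a b :: "complex \<Rightarrow> quat"
  assumes cont: "continuous_on UNIV a" "continuous_on UNIV b" "continuous_on UNIV n"
    and ab: "\<And>z. a z \<in> ImH" "\<And>z. b z \<in> ImH" "\<And>z. inner (a z) (b z) = 0"
      "\<And>z. inner (a z) (a z) = (n z)\<^sup>2" "\<And>z. inner (b z) (b z) = (n z)\<^sup>2"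
    and n: "\<And>z. n z > 0"
  obtains l where "continuous_on UNIV l" "\<And>z. qcnj (l z) * quat_j * l z = a z"
    "\<And>z. qcnj (l z) * quat_k * l z = b z" "\<And>z. inner (l z) (l z) = n z"
    "\<And>z m. spin_matrix (n z) (a z) (b z) m = inner (l z) m *\<^sub>R l z"
proof -
  have "\<exists>l. qcnj l * quat_j * l = a z \<and> qcnj l * quat_k * l = b z \<and> inner l l = n z" for z
    using conformal_frame_eq_spin[OF ab n] by metis
  then obtain p where p: "\<And>z. qcnj (p z) * quat_j * p z = a z"
    "\<And>z. qcnj (p z) * quat_k * p z = b z" "\<And>z. inner (p z) (p z) = n z"
    by metis
  have p0: "p z \<noteq> 0" for z
    using p(3)[of z] n[of z] by auto
  have sm: "spin_matrix (n z) (a z) (b z) m = inner (p z) m *\<^sub>R p z" for z m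
    using spin_matrix_eq_rank_one[OF p0, of z m] by (simp add: p)
  have n0: "\<forall>z. n z \<noteq> 0"
    using n by (metis less_irrefl)
  have contM: "continuous_on UNIV (\<lambda>z. rank_one (p z))"
  proof (rule continuous_on_blinfun_componentwise)
    show "continuous_on UNIV (\<lambda>z. rank_one (p z) m)" for m
      unfolding rank_one_apply sm[symmetric] spin_matrix_def
      using n0 by (intro continuous_intros cont) auto
  qed
  obtain l where l: "continuous_on UNIV l" "\<And>z. rank_one (l z) = rank_one (p z)"
  proof (rule covering_space_lift[OF covering_space_rank_one _ _ contM])
    show "simply_connected (UNIV::complex set)" "locally path_connected (UNIV::complex set)"
      by (simp_all add: convex_imp_simply_connected convex_imp_locally_path_connected)
  qed (use p0 in auto)
  have lp: "p z = l z \<or> p z = - l z" for z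
    using rank_one_eqD[OF l(2)] .
  \<comment> \<open>All properties of \<open>p\<close> are even in the spinor, so they pass to
    \<open>l\<close>, which equals \<open>p\<close> up to sign.\<close>
  have "qcnj (- x) = - qcnj x" for x
    by (simp add: quat_eq_iff)
  then have minus: "qcnj (- x) * u * (- x) = qcnj x * u * x" for x u
    by simp
  show ?thesis
  proof (rule that[OF l(1)])
    show "qcnj (l z) * quat_j * l z = a z" "qcnj (l z) * quat_k * l z = b z"
      "inner (l z) (l z) = n z" "spin_matrix (n z) (a z) (b z) m = inner (l z) m *\<^sub>R l z" for z m
      using lp[of z] p[of z] sm[of z m] minus[of "l z"] by auto
  qed
qed

text \<open>Evaluating the operator at the fixed vector \<open>l z\<close> gives the differentiable
  map \<open>G\<close>. By continuity \<open>inner (l y) (l z)\<close> is positive near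
  \<open>z\<close>, and there \<open>l\<close> is \<open>G\<close> divided by the root of
  \<open>inner (G y) (l z)\<close>.\<close>

lemma spin_lift_differentiable:
  fixes l :: "complex \<Rightarrow> quat"
  assumes diff: "a differentiable at z" "b differentiable at z" "n differentiable at z"
    and n: "n z > 0" and cont: "isCont l z" and l0: "l z \<noteq> 0"
    and l: "\<And>y m. spin_matrix (n y) (a y) (b y) m = inner (l y) m *\<^sub>R l y"
  shows "l differentiable at z"
proof -
  define G where "G y = spin_matrix (n y) (a y) (b y) (l z)" for y
  have G: "G differentiable at z"
    unfolding G_def spin_matrix_def using n
    by (intro differentiable_scaleR differentiable_diff differentiable_mult differentiable_divide
        differentiable_const diff) auto
  have Gl: "inner (G y) (l z) = (inner (l y) (l z))\<^sup>2" "G y = inner (l y) (l z) *\<^sub>R l y" for y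
    by (simp_all add: G_def l power2_eq_square)
  have pos: "inner (l z) (l z) > 0"
    using l0 by simp
  obtain G' where G': "(G has_derivative G') (at z)"
    using G by (auto simp: differentiable_def)
  have "((\<lambda>y. inverse (sqrt (inner (G y) (l z)))) has_derivative
      (\<lambda>h. - (inverse (sqrt (inner (G z) (l z))) *
        (inner (G' h) (l z) * (inverse (sqrt (inner (G z) (l z))) / 2)) *
        inverse (sqrt (inner (G z) (l z)))))) (at z)"
    using pos by (intro Deriv.has_derivative_inverse has_derivative_real_sqrt has_derivative_inner_left G')
      (auto simp: Gl)
  from has_derivative_scaleR[OF this G']
  have "(\<lambda>y. inverse (sqrt (inner (G y) (l z))) *\<^sub>R G y) differentiable at z"
    by (auto simp: differentiable_def)
  moreover have "\<forall>\<^sub>F y in at z. inverse (sqrt (inner (G y) (l z))) *\<^sub>R G y = l y"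
  proof -
    have "((\<lambda>y. inner (l y) (l z)) \<longlongrightarrow> inner (l z) (l z)) (at z)"
      using cont unfolding isCont_def by (intro tendsto_intros)
    from order_tendstoD(1)[OF this pos] show ?thesis
      by eventually_elim (simp add: Gl)
  qed
  moreover have "inverse (sqrt (inner (G z) (l z))) *\<^sub>R G z = l z"
    using pos by (simp add: Gl)
  ultimately show ?thesis
    by (auto simp: differentiable_def intro: has_derivative_transform_eventually)
qed

section \<open>Smoothness of the lift and integrability\<close>

lemma bounded_linear_qcnj: "bounded_linear qcnj"
  by (rule linear_conv_bounded_linear[THEN iffD1]) (auto intro!: linearI simp: quat_eq_iff)

lemma bounded_linear_qre: "bounded_linear qre"
  by (rule linear_conv_bounded_linear[THEN iffD1]) (auto intro!: linearI)

lemma has_derivative_qcnj [derivative_intros]: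
  "(l has_derivative l') F \<Longrightarrow> ((\<lambda>z. qcnj (l z)) has_derivative (\<lambda>v. qcnj (l' v))) F"
  by (rule bounded_linear.has_derivative[OF bounded_linear_qcnj])

lemma has_derivative_qcnj_conjugate:
  assumes "(l has_derivative l') (at z)"
  shows "((\<lambda>z. qcnj (l z) * u * l z) has_derivative
    (\<lambda>v. qcnj (l' v) * u * l z + qcnj (l z) * u * l' v)) (at z)"
  by (rule derivative_eq_intros assms refl)+ (simp add: fun_eq_iff add.commute)

text \<open>Together with \<open>spin_log_k\<close> this inverts the frame derivatives. The
  expression \<open>qcnj X * quat_j + quat_j * X\<close> determines every component of
  \<open>X\<close> except the \<open>quat_j\<close> one, which the analogous expression in
  \<open>quat_k\<close> supplies.\<close>

definition spin_log_j :: "quat \<Rightarrow> quat" where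
  "spin_log_j q = Quat (qim2 q / 2) (- qim3 q / 2) 0 (qim1 q / 2)"

definition spin_log_k :: "quat \<Rightarrow> quat" where
  "spin_log_k q = Quat 0 0 (- qim1 q / 2) 0"

lemma bounded_linear_spin_log: "bounded_linear spin_log_j" "bounded_linear spin_log_k"
  by (rule linear_conv_bounded_linear[THEN iffD1],
      auto intro!: linearI simp: quat_eq_iff spin_log_j_def spin_log_k_def field_simps)+

text \<open>With \<open>p = X * l\<close>, both differentiated frame vectors are conjugates by \<open>l\<close> of
  \<open>qcnj X * j + j * X\<close> and \<open>qcnj X * k + k * X\<close>, from which the four components of \<open>X\<close> are read off.\<close>

lemma spin_log_eq:
  fixes l p :: quat
  defines "a' \<equiv> qcnj p * quat_j * l + qcnj l * quat_j * p"
    and "b' \<equiv> qcnj p * quat_k * l + qcnj l * quat_k * p"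
    and "E \<equiv> (inner l l)\<^sup>2"
  assumes "l \<noteq> 0"
  shows "(spin_log_j (inverse E *\<^sub>R (l * a' * qcnj l)) + spin_log_k (inverse E *\<^sub>R (l * b' * qcnj l))) * l = p"
proof -
  define N where "N = inner l l"
  have N: "N \<noteq> 0" using assms by (simp add: N_def)
  define X where "X = inverse N *\<^sub>R (p * qcnj l)"
  have p: "p = X * l"
    using N by (simp add: X_def mult.assoc qcnj_mult_self of_real_mult_quat flip: N_def)
  have conj: "inverse E *\<^sub>R (l * (qcnj p * u * l + qcnj l * u * p) * qcnj l) = qcnj X * u + u * X" for u
  proof -
    have "l * (qcnj p * u * l + qcnj l * u * p) * qcnj l
        = (l * qcnj l) * (qcnj X * u + u * X) * (l * qcnj l)"
      by (simp add: p qcnj_mult distrib_left distrib_right mult.assoc)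
    also have "\<dots> = E *\<^sub>R (qcnj X * u + u * X)"
      by (simp add: mult_qcnj_self of_real_mult_quat E_def power2_eq_square)
    finally show ?thesis using N by (simp add: E_def N_def)
  qed
  show ?thesis
    unfolding a'_def b'_def conj by (simp add: p quat_eq_iff spin_log_j_def spin_log_k_def)
qed

text \<open>Bootstrapping: \<open>spin_log_eq\<close> writes the derivative of \<open>l\<close>
  through \<open>l\<close>, the frame derivatives and the inverse of \<open>E\<close>, so each order
  yields the next. The squared form of \<open>E\<close> equals \<open>inner a a\<close> in the
  application, which is smooth without taking a root.\<close>

lemma smooth_spin_lift:
  fixes l a b :: "complex \<Rightarrow> quat"
  assumes diff: "\<And>z. l differentiable at z" and l0: "\<And>z. l z \<noteq> 0"
    and "smooth a" "smooth b"
    and E: "smooth (\<lambda>z. (inner (l z) (l z))\<^sup>2)"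
    and a: "\<And>z. qcnj (l z) * quat_j * l z = a z" and b: "\<And>z. qcnj (l z) * quat_k * l z = b z"
  shows "smooth l"
proof -
  define E where "E z = (inner (l z) (l z))\<^sup>2" for z
  note mult = times_continuously_differentiable_bilinear[OF bounded_bilinear_mult]
    and scale = times_continuously_differentiable_bilinear[OF bounded_bilinear_scaleR]
  have dl: "(l has_derivative differential l z) (at z)" for z
    using diff has_differential by blast
  have da: "differential a z v
      = qcnj (differential l z v) * quat_j * l z + qcnj (l z) * quat_j * differential l z v"
    and db: "differential b z v
      = qcnj (differential l z v) * quat_k * l z + qcnj (l z) * quat_k * differential l z v" for z v
    using has_derivative_qcnj_conjugate[OF dl, THEN differential_eqI, of quat_j]
      has_derivative_qcnj_conjugate[OF dl, THEN differential_eqI, of quat_k]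
    unfolding a b by simp_all
  have eq: "differential l z v =
      (spin_log_j (inverse (E z) *\<^sub>R (l z * differential a z v * qcnj (l z)))
        + spin_log_k (inverse (E z) *\<^sub>R (l z * differential b z v * qcnj (l z)))) * l z" for z v
    unfolding da db E_def using spin_log_eq[OF l0] by simp
  have "times_continuously_differentiable n l" for n
  proof (induction n)
    case 0
    show ?case
      using diff by (auto intro!: continuous_at_imp_continuous_on differentiable_imp_continuous_within)
  next
    case (Suc n)
    have ab: "times_continuously_differentiable n (\<lambda>z. differential a z v)"
      "times_continuously_differentiable n (\<lambda>z. differential b z v)" for v
      using \<open>smooth a\<close> \<open>smooth b\<close> smooth_differential unfolding smooth_def by blast+
    have "times_continuously_differentiable n (\<lambda>z. inverse (E z))"
      using E l0 unfolding smooth_def E_def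
      by (intro times_continuously_differentiable_inverse) auto
    then show ?case
      by (intro times_continuously_differentiable_SucI[OF dl], subst eq)
        (intro mult times_continuously_differentiable_add scale Suc.IH ab
          times_continuously_differentiable_bounded_linear[OF bounded_linear_spin_log(1)]
          times_continuously_differentiable_bounded_linear[OF bounded_linear_spin_log(2)]
          times_continuously_differentiable_bounded_linear[OF bounded_linear_qcnj])
  qed
  then show ?thesis by (simp add: smooth_def)
qed

section \<open>Inner products of frame derivatives and the integrability condition\<close>

lemma inner_quat_mult_left: "inner (x * u) (x * v) = inner x x * inner u v" for u :: quat
  by (simp add: inner_quat_def algebra_simps)

lemma inner_qcnj_ImH: "c \<in> ImH \<Longrightarrow> inner (qcnj x) c = - inner x c"
  by (simp add: ImH_iff inner_quat_def)

lemma ImH_conjugate: "u \<in> ImH \<Longrightarrow> qcnj l * u * l \<in> ImH"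
  by (simp add: ImH_iff algebra_simps)

text \<open>The first summand is minus the conjugate of the second, so both pair equally with an
  imaginary vector; left multiplication by \<open>qcnj l\<close> then scales inner products by
  \<open>inner l l\<close>.\<close>

lemma inner_conjugate_derivative:
  assumes "u \<in> ImH" "v \<in> ImH"
  shows "inner (qcnj p * u * l + qcnj l * u * p) (qcnj l * v * l) = 2 * inner l l * inner (u * p) (v * l)"
proof -
  have "qcnj u = - u"
    using assms(1) by (simp add: ImH_def eq_neg_iff_add_eq_0 add.commute)
  then have "qcnj p * u * l = - qcnj (qcnj l * u * p)"
    by (simp add: qcnj_mult qcnj_qcnj mult.assoc)
  then have "inner (qcnj p * u * l + qcnj l * u * p) (qcnj l * v * l)
      = 2 * inner (qcnj l * (u * p)) (qcnj l * (v * l))"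
    using inner_qcnj_ImH[OF ImH_conjugate[OF assms(2)]] by (simp add: inner_diff_left mult.assoc)
  moreover have "inner (qcnj l) (qcnj l) = inner l l"
    by (simp add: inner_quat_def)
  ultimately show ?thesis
    by (simp only: inner_quat_mult_left)
qed

lemma dirac_plane_eq:
  "dirac plane l z = - (quat_j * differential l z \<i> + quat_k * differential l z 1)"
proof -
  have "area_density plane z = 1"
    by (simp add: area_density_def first_form_def differential_plane inner_quat_def)
  then show ?thesis
    by (simp add: dirac_def differential_plane quat_eq_iff)
qed

text \<open>For \<open>p\<close> and \<open>q\<close> the x- and y-derivatives of \<open>l\<close>,
  the first hypothesis is the equality of the mixed derivatives of \<open>f\<close>. Rearranged, it
  makes \<open>qcnj l * D\<close> self-conjugate, hence real, and multiplication by \<open>l\<close>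
  recovers \<open>D\<close>.\<close>

lemma spin_integrability:
  assumes "qcnj q * quat_j * l + qcnj l * quat_j * q = - (qcnj p * quat_k * l + qcnj l * quat_k * p)"
    and "l \<noteq> 0"
  shows "quat_j * q + quat_k * p = (inner (quat_j * q + quat_k * p) l / inner l l) *\<^sub>R l"
proof -
  define N where "N = inner l l"
  have N: "N \<noteq> 0" using assms(2) by (simp add: N_def)
  define D where "D = quat_j * q + quat_k * p"
  have neg_add_swap: "- (w + y) = x + z" if "w + x = - (y + z)" for w x y z :: quat
    using that by (auto simp: quat_eq_iff)
  have "qcnj (qcnj l * D) = qcnj l * D"
  proof -
    have "qcnj (qcnj l * D) = - (qcnj q * quat_j * l + qcnj p * quat_k * l)"
      by (simp add: D_def quat_eq_iff algebra_simps)
    also have "\<dots> = qcnj l * D"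
      using assms(1) neg_add_swap[of "qcnj q * quat_j * l" "qcnj l * quat_j * q"]
      by (simp add: D_def distrib_left mult.assoc)
    finally show ?thesis .
  qed
  moreover have "q = of_real (qre q)" if "qcnj q = q" for q
    using that by (simp add: quat_eq_iff of_real_def)
  ultimately have "qcnj l * D = of_real (qre (qcnj l * D))"
    by blast
  also have "qre (qcnj l * D) = inner D l"
    by (simp add: inner_quat_def algebra_simps)
  finally have "l * (qcnj l * D) = inner D l *\<^sub>R l"
    by (simp add: of_real_mult_quat)
  moreover have "l * (qcnj l * D) = N *\<^sub>R D"
    by (simp add: mult_qcnj_self of_real_mult_quat N_def flip: mult.assoc)
  ultimately have "N *\<^sub>R D = inner D l *\<^sub>R l"
    by simp
  then have "D = (inner D l / N) *\<^sub>R l"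
    using N by (metis divideR_right inverse_eq_divide scaleR_scaleR mult.commute times_divide_eq_right mult.right_neutral)
  then show ?thesis by (simp add: D_def N_def)
qed

section \<open>Mean curvature and the Dirac equation\<close>

lemma conformal_immersion_frame:
  assumes "conformal_immersion f"
  shows "smooth f" "differential f z v \<in> ImH"
    "inner (differential f z 1) (differential f z \<i>) = 0"
    "inner (differential f z \<i>) (differential f z \<i>) = inner (differential f z 1) (differential f z 1)"
    "inner (differential f z 1) (differential f z 1) > 0"
proof -
  show f: "smooth f"
    using assms by (simp add: conformal_immersion_def)
  have "qre (f y) = 0" for y
    using assms by (auto simp: conformal_immersion_def simp flip: ImH_iff)
  \<comment> \<open>The real part of \<open>f\<close> vanishes identically, hence so does its
    derivative.\<close>
  then have "((\<lambda>y. 0) has_derivative (\<lambda>v. qre (differential f z v))) (at z)"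
    using bounded_linear.has_derivative[OF bounded_linear_qre smooth_imp_has_derivative[OF f], of z]
    by simp
  then have "(\<lambda>v. qre (differential f z v)) = (\<lambda>v. 0)"
    using has_derivative_unique has_derivative_const by blast
  then show "differential f z v \<in> ImH"
    by (metis ImH_iff)
  obtain r where "r > 0" "\<And>v w. inner (differential f z v) (differential f z w) = r * inner v w"
    using assms unfolding conformal_immersion_def first_form_def by metis
  then show "inner (differential f z 1) (differential f z \<i>) = 0"
    "inner (differential f z \<i>) (differential f z \<i>) = inner (differential f z 1) (differential f z 1)"
    "inner (differential f z 1) (differential f z 1) > 0"
    by (simp_all add: inner_complex_def)
qed

lemma linear_complex_eq:
  fixes f :: "complex \<Rightarrow> 'a::real_vector"
  assumes "linear f"
  shows "f v = Re v *\<^sub>R f 1 + Im v *\<^sub>R f \<i>"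
proof -
  have "v = Re v *\<^sub>R 1 + Im v *\<^sub>R \<i>"
    by (simp add: complex_eq_iff)
  then show ?thesis
    using assms by (metis linear_add linear_scale)
qed

lemma conformal_immersion_spin_transformation:
  assumes "conformal_immersion f"
  obtains l where "smooth l" "\<And>z. l z \<noteq> 0"
    "\<And>z. (f has_derivative (\<lambda>v. qcnj (l z) * (quat_j * quat_of_complex v) * l z)) (at z)"
proof -
  note frame = conformal_immersion_frame[OF assms]
  define a where "a z = differential f z 1" for z
  \<comment> \<open>The sign comes from \<open>quat_j * quat_i = - quat_k\<close>: the differential
    at \<open>\<i>\<close> must be \<open>- (qcnj l * quat_k * l)\<close>.\<close>
  define b where "b z = - differential f z \<i>" for z
  define n where "n z = norm (a z)" for z
  have sa: "smooth a" and sb: "smooth b"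
    using smooth_differential[OF frame(1)]
      times_continuously_differentiable_bounded_linear[OF bounded_linear_minus[OF bounded_linear_ident]]
    unfolding a_def b_def smooth_def by blast+
  have ab: "a z \<in> ImH" "b z \<in> ImH" "inner (a z) (b z) = 0"
      "inner (a z) (a z) = (n z)\<^sup>2" "inner (b z) (b z) = (n z)\<^sup>2" for z
    using frame(2)[of z 1] frame(2)[of z \<i>] frame(3,4)[of z]
    by (simp_all add: a_def b_def n_def power2_norm_eq_inner ImH_iff)
  have n: "n z > 0" for z
    using frame(5)[of z] by (auto simp: n_def a_def)
  have a0: "a z \<noteq> 0" for z
    using n[of z] by (auto simp: n_def)
  have da: "a differentiable at z" and db: "b differentiable at z" for z
    using sa sb smooth_imp_has_derivative by (auto simp: differentiable_def)
  have dn: "n differentiable at z" for z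
    using differentiable_chain_at[OF da differentiable_norm_at[OF a0], of z]
    by (simp add: n_def[abs_def] o_def)
  obtain l where l: "continuous_on UNIV l" "\<And>z. qcnj (l z) * quat_j * l z = a z"
    "\<And>z. qcnj (l z) * quat_k * l z = b z" "\<And>z. inner (l z) (l z) = n z"
    "\<And>z m. spin_matrix (n z) (a z) (b z) m = inner (l z) m *\<^sub>R l z"
    by (rule continuous_spin_lift[of a b n])
      (use ab n in \<open>auto intro: smooth_imp_continuous sa sb
        differentiable_imp_continuous_on differentiable_at_imp_differentiable_on dn\<close>)
  have l0: "l z \<noteq> 0" for z
    using l(4)[of z] n[of z] by auto
  have dl: "l differentiable at z" for z
    using spin_lift_differentiable[OF da db dn n _ l0 l(5)] l(1)
    by (simp add: continuous_on_eq_continuous_at)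
  have "times_continuously_differentiable m (\<lambda>z. inner (a z) (a z))" for m
    using sa times_continuously_differentiable_bilinear[OF bounded_bilinear_inner]
    unfolding smooth_def by blast
  then have "smooth (\<lambda>z. (inner (l z) (l z))\<^sup>2)"
    by (simp add: smooth_def l(4) ab(4))
  with smooth_spin_lift[OF dl l0 sa sb _ l(2,3)] have sl: "smooth l" .
  have "differential f z v = qcnj (l z) * (quat_j * quat_of_complex v) * l z" for z v
  proof -
    have "linear (\<lambda>v. qcnj (l z) * (quat_j * quat_of_complex v) * l z)"
      by (auto intro!: linearI simp: quat_eq_iff algebra_simps)
    note this[THEN linear_complex_eq, of v]
    also have "qcnj (l z) * (quat_j * quat_of_complex 1) * l z = differential f z 1"
      using l(2)[of z] by (simp add: a_def quat_of_complex_def[of 1] one_quat_def zero_quat_def quat_eq_iff)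
    also have "quat_j * quat_of_complex \<i> = - quat_k"
      by (simp add: quat_eq_iff)
    also have "qcnj (l z) * (- quat_k) * l z = differential f z \<i>"
      using l(3)[of z] by (simp add: b_def minus_equation_iff)
    also have "Re v *\<^sub>R differential f z 1 + Im v *\<^sub>R differential f z \<i> = differential f z v"
      using linear_complex_eq[OF has_derivative_linear[OF smooth_imp_has_derivative[OF frame(1)]]]
      by metis
    finally show ?thesis by simp
  qed
  then show ?thesis
    using that[OF sl l0] smooth_imp_has_derivative[OF frame(1)]
    by (metis (no_types, lifting) ext)
qed

text \<open>Integrability gives the eigenvalue \<open>- (r / N)\<close>. The induced metric is
  \<open>N * N\<close> times the standard one and the trace of the second form is
  \<open>2 * r\<close>, so the mean curvature times \<open>N\<close> is
  \<open>r / N\<close>.\<close>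

lemma spin_transformation_dirac:
  assumes sl: "smooth l" and l0: "\<And>z. l z \<noteq> 0"
    and f: "\<And>z. (f has_derivative (\<lambda>v. qcnj (l z) * (quat_j * quat_of_complex v) * l z)) (at z)"
    and "smooth f"
  shows "dirac plane l z = - (mean_curvature f z * inner (l z) (l z)) *\<^sub>R l z"
proof -
  define N where "N = inner (l z) (l z)"
  define p where "p = differential l z 1"
  define q where "q = differential l z \<i>"
  define r where "r = inner (quat_j * q + quat_k * p) (l z)"
  have N: "N > 0" using l0 by (simp add: N_def)
  have f1: "differential f y 1 = qcnj (l y) * quat_j * l y"
    and fi: "differential f y \<i> = - (qcnj (l y) * quat_k * l y)" for y
  proof -
    have "quat_of_complex 1 = 1" "quat_j * quat_of_complex \<i> = - quat_k"
      by (simp_all add: quat_eq_iff)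
    then show "differential f y 1 = qcnj (l y) * quat_j * l y"
      "differential f y \<i> = - (qcnj (l y) * quat_k * l y)"
      by (simp_all add: differential_eqI[OF f])
  qed
  note dl = has_derivative_qcnj_conjugate[OF smooth_imp_has_derivative[OF sl]]
  have f1': "differential (\<lambda>y. differential f y 1) z v
      = qcnj (differential l z v) * quat_j * l z + qcnj (l z) * quat_j * differential l z v"
    and fi': "differential (\<lambda>y. differential f y \<i>) z v
      = - (qcnj (differential l z v) * quat_k * l z + qcnj (l z) * quat_k * differential l z v)" for v
    unfolding f1 fi
    by (simp_all add: differential_eqI[OF dl] differential_eqI[OF has_derivative_minus[OF dl]])
  have "quat_j * q + quat_k * p = (r / N) *\<^sub>R l z"
    unfolding r_def N_def
    by (rule spin_integrability[OF _ l0])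
      (use symmetric_second_differential[OF \<open>smooth f\<close>, of 1 z \<i>] in \<open>simp add: f1' fi' p_def q_def\<close>)
  then have dir: "dirac plane l z = - (r / N) *\<^sub>R l z"
    by (simp add: dirac_plane_eq p_def q_def)
  have conj: "inner (qcnj (l z) * u * l z) (qcnj (l z) * v * l z) = N * N * inner u v" for u v
    unfolding N_def by (simp add: inner_quat_def algebra_simps)
  have EFG: "first_form f z 1 1 = N * N" "first_form f z 1 \<i> = 0" "first_form f z \<i> \<i> = N * N"
    by (simp_all add: first_form_def f1 fi conj, simp_all add: inner_quat_def)
  define c where "c = qcnj (l z) * quat_i * l z"
  \<comment> \<open>The product of the conjugates of \<open>quat_j\<close> and \<open>quat_k\<close>
    is \<open>N\<close> times that of \<open>quat_i\<close>; the minus sign comes from the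
    y-derivative of \<open>f\<close>.\<close>
  have "qcross (differential f z 1) (differential f z \<i>) = - (N *\<^sub>R c)"
  proof -
    have "(qcnj (l z) * u * l z) * (qcnj (l z) * v * l z) = N *\<^sub>R (qcnj (l z) * (u * v) * l z)" for u v
    proof -
      have "(qcnj (l z) * u * l z) * (qcnj (l z) * v * l z)
          = qcnj (l z) * u * (l z * qcnj (l z)) * v * l z"
        by (simp add: mult.assoc)
      then show ?thesis
        by (simp add: mult_qcnj_self of_real_mult_quat N_def mult.assoc)
    qed
    moreover have "(1/2) *\<^sub>R (- x - x) = - x" for x :: quat
      by (simp add: quat_eq_iff)
    ultimately show ?thesis
      by (simp add: qcross_def f1 fi c_def quat_unit_mult)
  qed
  moreover have "norm c = N"
    using conj[of quat_i quat_i] N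
    by (simp add: c_def norm_eq_sqrt_inner) (simp add: inner_quat_def)
  ultimately have normal: "unit_normal f z = - ((1 / N) *\<^sub>R c)"
    using N by (simp add: unit_normal_def sgn_div_norm field_simps)
  have "quat_i \<in> ImH" "quat_j \<in> ImH" "quat_k \<in> ImH"
    by (simp_all add: ImH_iff)
  then have "second_form f z 1 1 + second_form f z \<i> \<i>
      = - 2 * inner (quat_j * p) (quat_i * l z) + 2 * inner (quat_k * q) (quat_i * l z)"
    using N
    unfolding second_form_def f1' fi' normal c_def p_def q_def
      inner_minus_left inner_minus_right inner_scaleR_right
    by (simp add: inner_conjugate_derivative flip: N_def)
  \<comment> \<open>Left multiplication by \<open>quat_i\<close> is skew. Moving it across the inner
    products turns \<open>quat_j * p\<close> into \<open>quat_k * p\<close> and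
    \<open>quat_k * q\<close> into \<open>quat_j * q\<close>, up to sign.\<close>
  also have "\<dots> = 2 * r"
    by (simp add: r_def inner_quat_def algebra_simps)
  finally have "second_form f z 1 1 + second_form f z \<i> \<i> = 2 * r" .
  moreover have "mean_curvature f z = (second_form f z 1 1 + second_form f z \<i> \<i>) / (2 * (N * N))"
    using N unfolding mean_curvature_def Let_def EFG by (simp add: field_simps)
  ultimately have "mean_curvature f z * N = r / N"
    using N by simp
  then show ?thesis
    by (simp add: dir flip: N_def)
qed

section \<open>Constancy of the eigenvalue and the final system\<close>

text \<open>Only the values \<open>sqrt c\<close> and \<open>- sqrt c\<close> are possible, and a
  continuous function with finite range on a connected space is constant.\<close>

lemma continuous_square_const:
  fixes g :: "'a::real_normed_vector \<Rightarrow> real"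
  assumes "continuous_on UNIV g" "\<And>z. (g z)\<^sup>2 = c"
  obtains \<mu> where "\<And>z. g z = \<mu>"
proof -
  have "g z \<in> {sqrt c, - sqrt c}" for z
    using assms(2)[of z] by (auto simp: abs_if)
  then have "finite (range g)"
    by (meson finite.emptyI finite.insertI finite_subset image_subset_iff)
  then have "g constant_on UNIV"
    by (intro continuous_finite_range_constant assms(1)) auto
  then show ?thesis
    using that by (auto simp: constant_on_def)
qed

theorem theorem1:
  fixes f :: "complex \<Rightarrow> quat" and c :: real
  assumes "conformal_immersion f"
    and "c > 0"
    and "\<And>z v w. (mean_curvature f z)\<^sup>2 * first_form f z v w = c * inner v w"
  shows "\<exists>(l :: complex \<Rightarrow> quat) (l1 :: complex \<Rightarrow> complex) (l2 :: complex \<Rightarrow> complex) (\<mu> :: real).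
    smooth l \<and>
    spin_transformation plane l f \<and>
    (\<forall>z. (f has_derivative (\<lambda>v. qcnj (l z) * (quat_j * quat_of_complex v) * l z)) (at z)) \<and>
    (\<forall>z. dirac plane l z = \<mu> *\<^sub>R l z) \<and>
    (\<forall>z. l z = quat_of_complex (l1 z) + quat_j * quat_of_complex (l2 z)) \<and>
    (\<forall>z. 2 * \<i> * partial_z l2 z = of_real \<mu> * l1 z) \<and>
    (\<forall>z. 2 * \<i> * partial_zbar l1 z = of_real \<mu> * l2 z)"
proof -
  obtain l where l: "smooth l" "\<And>z. l z \<noteq> 0"
    and f: "\<And>z. (f has_derivative (\<lambda>v. qcnj (l z) * (quat_j * quat_of_complex v) * l z)) (at z)"
    using conformal_immersion_spin_transformation[OF assms(1)] by blast
  define g where "g z = - (mean_curvature f z * inner (l z) (l z))" for z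
  have g: "dirac plane l z = g z *\<^sub>R l z" for z
    using spin_transformation_dirac[OF l f] assms(1) by (simp add: g_def conformal_immersion_def)
  \<comment> \<open>Written as a Rayleigh quotient, \<open>g\<close> is continuous by the smoothness
    of \<open>l\<close> alone.\<close>
  have g_eq: "g z = inner (dirac plane l z) (l z) / inner (l z) (l z)" for z
    using l(2)[of z] by (simp add: g)
  have "continuous_on UNIV g"
    unfolding g_eq dirac_plane_eq using l(2)
    by (intro continuous_intros smooth_imp_continuous smooth_differential l(1)) auto
  moreover have "(g z)\<^sup>2 = c" for z
  proof -
    \<comment> \<open>Thus the square of \<open>g\<close> is the squared mean curvature times
      \<open>first_form f z 1 1\<close>, which the hypothesis makes \<open>c\<close>.\<close>
    have "first_form f z 1 1 = (inner (l z) (l z))\<^sup>2"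
      unfolding first_form_def differential_eqI[OF f]
      by (simp add: inner_quat_def power2_eq_square algebra_simps)
    then show ?thesis
      using assms(3)[of z 1 1] by (simp add: g_def power_mult_distrib)
  qed
  ultimately obtain \<mu> where \<mu>: "\<And>z. g z = \<mu>"
    using continuous_square_const by blast
  define l1 where "l1 z = Complex (qre (l z)) (qim1 (l z))" for z
  \<comment> \<open>The minus sign is again that of
    \<open>quat_j * quat_i = - quat_k\<close>.\<close>
  define l2 where "l2 z = Complex (qim2 (l z)) (- qim3 (l z))" for z
  have split: "l z = quat_of_complex (l1 z) + quat_j * quat_of_complex (l2 z)" for z
    by (simp add: l1_def l2_def quat_eq_iff)
  have lin: "bounded_linear (\<lambda>q. Complex (qre q) (qim1 q))" "bounded_linear (\<lambda>q. Complex (qim2 q) (- qim3 q))"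
    by (rule linear_conv_bounded_linear[THEN iffD1], auto intro!: linearI simp: complex_eq_iff)+
  have diff: "l1 differentiable at z" "l2 differentiable at z" for z
    using lin[THEN bounded_linear.has_derivative, OF smooth_imp_has_derivative[OF l(1)]]
    unfolding l1_def l2_def differentiable_def by blast+
  have "2 * \<i> * partial_z l2 z = of_real \<mu> * l1 z \<and> 2 * \<i> * partial_zbar l1 z = of_real \<mu> * l2 z" for z
  proof -
    have "quat_of_complex (2 * \<i> * partial_z l2 z) + quat_j * quat_of_complex (2 * \<i> * partial_zbar l1 z)
        = \<mu> *\<^sub>R (quat_of_complex (l1 z) + quat_j * quat_of_complex (l2 z))"
      using g[of z] dirac_plane[OF diff] by (simp add: \<mu> flip: split)
    then show ?thesis
      by (simp add: quat_eq_iff complex_eq_iff)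
  qed
  moreover have "spin_transformation plane l f"
    using f by (simp add: spin_transformation_def differential_plane)
  ultimately show ?thesis
    using l(1) f g \<mu> split by metis
qed

end
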